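(* Let $G$ be a graph and let $n\geq 4$ be an integer. Then \[\operatorname{Z}(G\times K_n)\le (n-2)|V(G)| + 2\operatorname{Z}^-(G).\]
   Context: All graphs are finite, simple and undirected. $K_n$ is the complete graph on $n$ vertices. The tensor product $G\times H$ has vertex set $V(G)\times V(H)$, with $(g,h)$ adjacent to $(g',h')$ iff $g\sim g'$ in $G$ and $h\sim h'$ in $H$. Zero forcing: vertices are colored blue or white; the color change rule says that if a blue vertex $u$ has exactly one white neighbor $w$, then $w$ is changed to blue. A zero forcing set is a set $B$ of vertices such that, coloring $B$ blue and all other vertices white, repeated application of the color change rule eventually colors all vertices blue; $\operatorname{Z}(G)$ is the minimum cardinality of a zero forcing set. Skew zero forcing: the skew color change rule says that if any vertex $v$ (blue or white) has exactly one white neighbor $w$, then $w$ is changed to blue. A skew zero forcing set is a (possibly empty) set of initially blue vertices from which repeated application of the skew color change rule colors all vertices blue; $\operatorname{Z}^-(G)$ is the minimum cardinality of a skew zero forcing set. *)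

theory Defs
  imports "Graph_Theory.Graph_Theory"
begin

text \<open>
  Finite simple undirected graphs are rendered as \<^locale>\<open>pair_graph\<close>s: an undirected edge is a pair
  of opposite arcs, so \<open>u \<rightarrow>\<^bsub>G\<^esub> w\<close> means that \<open>u\<close> and \<open>w\<close> are adjacent.
\<close>

definition tensor_product ::
    "'a pair_pre_digraph \<Rightarrow> 'b pair_pre_digraph \<Rightarrow> ('a \<times> 'b) pair_pre_digraph" where
  "tensor_product G H =
    \<lparr> pverts = pverts G \<times> pverts H,
      parcs = {((g, h), (g', h')) | g h g' h'. g \<rightarrow>\<^bsub>G\<^esub> g' \<and> h \<rightarrow>\<^bsub>H\<^esub> h'} \<rparr>"

definition white_neighbors :: "'a pair_pre_digraph \<Rightarrow> 'a set \<Rightarrow> 'a \<Rightarrow> 'a set" where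
  "white_neighbors G S v = {w. v \<rightarrow>\<^bsub>G\<^esub> w \<and> w \<notin> S}"

text \<open>A colouring is given by its set of blue vertices; each step is one application of the rule.\<close>

inductive color_change :: "'a pair_pre_digraph \<Rightarrow> 'a set \<Rightarrow> 'a set \<Rightarrow> bool" for G where
  "u \<in> S \<Longrightarrow> white_neighbors G S u = {w} \<Longrightarrow> color_change G S (insert w S)"

inductive skew_color_change :: "'a pair_pre_digraph \<Rightarrow> 'a set \<Rightarrow> 'a set \<Rightarrow> bool" for G where
  "v \<in> pverts G \<Longrightarrow> white_neighbors G S v = {w} \<Longrightarrow> skew_color_change G S (insert w S)"

definition zero_forcing_set :: "'a pair_pre_digraph \<Rightarrow> 'a set \<Rightarrow> bool" where
  "zero_forcing_set G B \<longleftrightarrow> B \<subseteq> pverts G \<and> (color_change G)\<^sup>*\<^sup>* B (pverts G)"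

definition skew_zero_forcing_set :: "'a pair_pre_digraph \<Rightarrow> 'a set \<Rightarrow> bool" where
  "skew_zero_forcing_set G B \<longleftrightarrow> B \<subseteq> pverts G \<and> (skew_color_change G)\<^sup>*\<^sup>* B (pverts G)"

definition zero_forcing_number :: "'a pair_pre_digraph \<Rightarrow> nat" where
  "zero_forcing_number G = Min (card ` {B. zero_forcing_set G B})"

definition skew_zero_forcing_number :: "'a pair_pre_digraph \<Rightarrow> nat" where
  "skew_zero_forcing_number G = Min (card ` {B. skew_zero_forcing_set G B})"

lemma zero_forcing_number_attained:
  assumes "finite (pverts G)"
  shows "\<exists>B. zero_forcing_set G B \<and> card B = zero_forcing_number G"
proof -
  have "finite {B. zero_forcing_set G B}"
    by (rule finite_subset[of _ "Pow (pverts G)"]) (auto simp: zero_forcing_set_def assms)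
  moreover have "pverts G \<in> {B. zero_forcing_set G B}"
    by (simp add: zero_forcing_set_def)
  ultimately have "zero_forcing_number G \<in> card ` {B. zero_forcing_set G B}"
    unfolding zero_forcing_number_def by (intro Min_in) auto
  then show ?thesis by auto
qed

lemma skew_zero_forcing_number_attained:
  assumes "finite (pverts G)"
  shows "\<exists>B. skew_zero_forcing_set G B \<and> card B = skew_zero_forcing_number G"
proof -
  have "finite {B. skew_zero_forcing_set G B}"
    by (rule finite_subset[of _ "Pow (pverts G)"]) (auto simp: skew_zero_forcing_set_def assms)
  moreover have "pverts G \<in> {B. skew_zero_forcing_set G B}"
    by (simp add: skew_zero_forcing_set_def)
  ultimately have "skew_zero_forcing_number G \<in> card ` {B. skew_zero_forcing_set G B}"
    unfolding skew_zero_forcing_number_def by (intro Min_in) auto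
  then show ?thesis by auto
qed

end

theory Submission
  imports Defs
begin

text \<open>
  Fix two disjoint pairs of vertices of \<open>K\<^sub>n\<close>. Give every vertex \<open>w\<close> of \<open>G\<close> that is still white one of
  these pairs, and colour white exactly the copies of \<open>w\<close> indexed by its pair. If \<open>v\<close> skew-forces \<open>w\<close>
  and either \<open>v\<close> is blue or its pair differs from the pair \<open>{p, q}\<close> of \<open>w\<close>, then \<open>(v, p)\<close> and \<open>(v, q)\<close>
  are blue; the former forces \<open>(w, q)\<close> and then the latter forces \<open>(w, p)\<close>. The pairs can be chosen
  suitably by going backwards through the skew forcing process: \<open>w\<close> turns blue at this step, so its
  pair does not matter for any later step and may be taken opposite to that of \<open>v\<close>.
\<close>

lemma tensor_product_simps:
  "pverts (tensor_product G H) = pverts G \<times> pverts H"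
  "((g, h), (g', h')) \<in> parcs (tensor_product G H) \<longleftrightarrow> (g, g') \<in> parcs G \<and> (h, h') \<in> parcs H"
  by (auto simp: tensor_product_def)

lemma zero_forcing_number_le_card:
  assumes "finite (pverts G)" "zero_forcing_set G B"
  shows "zero_forcing_number G \<le> card B"
proof -
  have "finite {B. zero_forcing_set G B}"
    by (rule finite_subset[of _ "Pow (pverts G)"]) (auto simp: zero_forcing_set_def assms)
  then show ?thesis
    unfolding zero_forcing_number_def using assms(2) by (intro Min_le) auto
qed

text \<open>The value of \<open>P\<close> on \<open>S\<close> has no effect, so \<open>P\<close> can
  be a total function and can be changed at blue vertices without altering the coloring.\<close>

definition lift_coloring ::
    "'a set \<Rightarrow> 'b set \<Rightarrow> ('a \<Rightarrow> 'b set) \<Rightarrow> 'a set \<Rightarrow> ('a \<times> 'b) set" where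
  "lift_coloring V W P S = {(w, h). w \<in> V \<and> h \<in> W \<and> (w \<in> S \<or> h \<notin> P w)}"

text \<open>Count over each \<open>w\<close> in \<open>V\<close>: its copies are indexed by all of
  \<open>W\<close> if \<open>w\<close> is in \<open>S\<close>, and by \<open>W\<close> minus a pair
  otherwise.\<close>

lemma card_lift_coloring:
  assumes "finite V" "finite W" "S \<subseteq> V" "\<And>w. P w \<subseteq> W \<and> card (P w) = 2"
  shows "card (lift_coloring V W P S) = (card W - 2) * card V + 2 * card S"
proof -
  have "finite S" "finite (P w)" for w
    using assms by (auto intro: finite_subset)
  have "lift_coloring V W P S = (SIGMA w:V. if w \<in> S then W else W - P w)"
    by (auto simp: lift_coloring_def split: if_splits)
  then have "card (lift_coloring V W P S) = (\<Sum>w\<in>V. card (if w \<in> S then W else W - P w))"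
    using assms by (simp add: card_SigmaI)
  also have "\<dots> = (\<Sum>w\<in>V. (card W - 2) + (if w \<in> S then 2 else 0))"
  proof (rule sum.cong[OF refl])
    fix w
    \<comment> \<open>Subtraction on naturals truncates; this bound makes
      \<open>(card W - 2) + 2\<close> equal to \<open>card W\<close>.\<close>
    have "2 \<le> card W"
      using assms(2,4) by (metis card_mono)
    then show "card (if w \<in> S then W else W - P w) = (card W - 2) + (if w \<in> S then 2 else 0)"
      using assms \<open>finite (P w)\<close> by (simp add: card_Diff_subset)
  qed
  also have "\<dots> = (card W - 2) * card V + (\<Sum>w\<in>V \<inter> S. 2)"
    using assms(1) by (simp add: sum.distrib flip: sum.inter_restrict)
  also have "V \<inter> S = S"
    using assms(3) by blast
  finally show ?thesis
    by simp
qed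

text \<open>Disjointness of \<open>P v\<close> and \<open>P w\<close> makes \<open>(v, p)\<close>
  and \<open>(v, q)\<close> blue whether or not \<open>v\<close> lies in \<open>S\<close>, so a skew
  force by a white \<open>v\<close> is covered too.\<close>

lemma color_change_lift_step:
  fixes G :: "'a pair_pre_digraph" and K :: "'b pair_pre_digraph"
  assumes "pair_graph G"
    and K: "\<And>h k. (h, k) \<in> parcs K \<longleftrightarrow> h \<in> pverts K \<and> k \<in> pverts K \<and> h \<noteq> k"
    and v: "v \<in> pverts G" "white_neighbors G S v = {w}"
    and pq: "P w = {p, q}" "p \<noteq> q" "p \<in> pverts K" "q \<in> pverts K"
    and disj: "P v \<inter> P w = {}"
  shows "(color_change (tensor_product G K))\<^sup>*\<^sup>*
    (lift_coloring (pverts G) (pverts K) P S) (lift_coloring (pverts G) (pverts K) P (insert w S))"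
proof -
  interpret pair_graph G by fact
  let ?T = "tensor_product G K" and ?L = "lift_coloring (pverts G) (pverts K) P"
  have vw: "(v, w) \<in> parcs G" "w \<notin> S"
    and only: "\<And>u. (v, u) \<in> parcs G \<Longrightarrow> u \<notin> S \<Longrightarrow> u = w"
    using v(2) by (auto simp: white_neighbors_def)
  have wV: "w \<in> pverts G"
    using vw(1) by (auto dest: in_arcsD2)
  have L: "(x, h) \<in> ?L S \<longleftrightarrow> x \<in> pverts G \<and> h \<in> pverts K \<and> (x \<in> S \<or> h \<notin> P x)" for x h
    by (simp add: lift_coloring_def)
  have in_verts: "u \<in> pverts G" if "(v, u) \<in> parcs G" for u
    using that by (auto dest: in_arcsD2)
  have blue: "(v, p) \<in> ?L S" "(v, q) \<in> ?L S"
    using v(1) pq disj by (auto simp: L)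
  \<comment> \<open>A neighbor \<open>(u, k)\<close> of \<open>(v, p)\<close> has
    \<open>k \<noteq> p\<close>, and it is white only if \<open>u = w\<close> and \<open>k\<close>
    lies in \<open>P w\<close>; this leaves \<open>k = q\<close>.\<close>
  have "white_neighbors ?T (?L S) (v, p) = {(w, q)}"
    using vw wV pq in_verts
    by (fastforce simp: white_neighbors_def tensor_product_simps K L dest: only)
  then have 1: "color_change ?T (?L S) (insert (w, q) (?L S))"
    using blue(1) by (rule color_change.intros[rotated])
  have "white_neighbors ?T (insert (w, q) (?L S)) (v, q) = {(w, p)}"
    using vw wV pq in_verts
    by (fastforce simp: white_neighbors_def tensor_product_simps K L dest: only)
  then have 2: "color_change ?T (insert (w, q) (?L S)) (insert (w, p) (insert (w, q) (?L S)))"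
    using blue(2) by (intro color_change.intros[of "(v, q)"]) auto
  have "insert (w, p) (insert (w, q) (?L S)) = ?L (insert w S)"
    using wV pq by (auto simp: lift_coloring_def)
  then show ?thesis
    using 1 2 by (metis rtranclp.rtrancl_into_rtrancl r_into_rtranclp)
qed

text \<open>The assignment \<open>c\<close> is existential because the induction, going from the
  last force to the first, amends it at every step. Booleans index the two pairs so that negation
  switches to the disjoint one.\<close>

lemma color_change_lift:
  fixes G :: "'a pair_pre_digraph" and K :: "'b pair_pre_digraph"
  assumes "pair_graph G"
    and K: "\<And>h k. (h, k) \<in> parcs K \<longleftrightarrow> h \<in> pverts K \<and> k \<in> pverts K \<and> h \<noteq> k"
    and Q: "\<And>i. Q i \<subseteq> pverts K \<and> card (Q i) = 2" "Q True \<inter> Q False = {}"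
    and "(skew_color_change G)\<^sup>*\<^sup>* S (pverts G)"
  shows "\<exists>c :: 'a \<Rightarrow> bool. (color_change (tensor_product G K))\<^sup>*\<^sup>*
    (lift_coloring (pverts G) (pverts K) (Q \<circ> c) S) (pverts (tensor_product G K))"
  using assms(5)
proof (induction rule: converse_rtranclp_induct)
  case base
  have "lift_coloring (pverts G) (pverts K) P (pverts G) = pverts (tensor_product G K)" for P
    by (auto simp: lift_coloring_def tensor_product_simps)
  then show ?case
    by simp
next
  case (step S S')
  interpret pair_graph G by fact
  from step.IH obtain c where c: "(color_change (tensor_product G K))\<^sup>*\<^sup>*
    (lift_coloring (pverts G) (pverts K) (Q \<circ> c) S') (pverts (tensor_product G K))"
    by blast
  from step.hyps(1) obtain v w where
    v: "v \<in> pverts G" "white_neighbors G S v = {w}" and S': "S' = insert w S"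
    by cases auto
  \<comment> \<open>Hence redefining \<open>c\<close> at \<open>w\<close> leaves the pair of
    \<open>v\<close> as it was.\<close>
  have "v \<noteq> w"
    using v(2) no_loops' by (auto simp: white_neighbors_def)
  let ?c = "c(w := \<not> c v)"
  obtain p q where pq: "Q (\<not> c v) = {p, q}" "p \<noteq> q"
    using Q(1) by (meson card_2_iff)
  have disj: "Q (c v) \<inter> Q (\<not> c v) = {}"
    using Q(2) by (cases "c v") auto
  have "p \<in> pverts K" "q \<in> pverts K"
    using Q(1)[of "\<not> c v"] pq by auto
  then have "(color_change (tensor_product G K))\<^sup>*\<^sup>*
    (lift_coloring (pverts G) (pverts K) (Q \<circ> ?c) S) (lift_coloring (pverts G) (pverts K) (Q \<circ> ?c) S')"
    unfolding S' using assms(1) K v pq disj \<open>v \<noteq> w\<close>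
    by (intro color_change_lift_step[where v = v and p = p and q = q]) auto
  \<comment> \<open>Both assignments agree away from \<open>w\<close>, and \<open>w\<close> is blue
    in \<open>S'\<close>.\<close>
  also have "lift_coloring (pverts G) (pverts K) (Q \<circ> ?c) S'
      = lift_coloring (pverts G) (pverts K) (Q \<circ> c) S'"
    by (auto simp: lift_coloring_def S')
  also note c
  finally show ?case
    by blast
qed

theorem theorem2p1:
  fixes G :: "'a pair_pre_digraph" and K :: "'b pair_pre_digraph" and n :: nat
  assumes "pair_graph G"
    and "n \<ge> 4"
    and "K\<^bsub>n\<^esub> (with_proj K)"
  shows "zero_forcing_number (tensor_product G K)
           \<le> (n - 2) * card (pverts G) + 2 * skew_zero_forcing_number G"
proof -
  interpret pair_graph G by fact
  have finK: "finite (pverts K)" and complete: "card (pverts K) = n"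
      "parcs K = {(u, v). (u, v) \<in> pverts K \<times> pverts K \<and> u \<noteq> v}"
    using assms(3) by (auto simp: complete_digraph_pair_def)
  have adj: "(h, k) \<in> parcs K \<longleftrightarrow> h \<in> pverts K \<and> k \<in> pverts K \<and> h \<noteq> k" for h k
    using complete(2) by auto
  have finG: "finite (pverts G)"
    by simp
  obtain A where A: "A \<subseteq> pverts K" "card A = 2"
    using complete(1) assms(2) obtain_subset_with_card_n[of 2 "pverts K"] by auto
  \<comment> \<open>Room for a second pair disjoint from \<open>A\<close> is what
    \<open>n \<ge> 4\<close> provides.\<close>
  have "2 \<le> card (pverts K - A)"
    using A finK complete(1) assms(2) by (simp add: card_Diff_subset finite_subset)
  then obtain B where B: "B \<subseteq> pverts K - A" "card B = 2"
    by (meson obtain_subset_with_card_n)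
  define Q where "Q i = (if i then A else B)" for i
  have Q: "Q i \<subseteq> pverts K \<and> card (Q i) = 2" "Q True \<inter> Q False = {}" for i
    using A B by (auto simp: Q_def)
  obtain S where S: "skew_zero_forcing_set G S" "card S = skew_zero_forcing_number G"
    using skew_zero_forcing_number_attained[OF finG] by blast
  have SV: "S \<subseteq> pverts G" and forces: "(skew_color_change G)\<^sup>*\<^sup>* S (pverts G)"
    using S(1) by (auto simp: skew_zero_forcing_set_def)
  obtain c where c: "(color_change (tensor_product G K))\<^sup>*\<^sup>*
      (lift_coloring (pverts G) (pverts K) (Q \<circ> c) S) (pverts (tensor_product G K))"
    using color_change_lift[OF assms(1) adj Q forces] by blast
  let ?B = "lift_coloring (pverts G) (pverts K) (Q \<circ> c) S"
  have "zero_forcing_set (tensor_product G K) ?B"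
    using c by (auto simp: zero_forcing_set_def lift_coloring_def tensor_product_simps)
  then have "zero_forcing_number (tensor_product G K) \<le> card ?B"
    using finG finK by (intro zero_forcing_number_le_card) (auto simp: tensor_product_simps)
  also have "card ?B = (card (pverts K) - 2) * card (pverts G) + 2 * card S"
    using finG finK SV Q(1) by (intro card_lift_coloring) auto
  finally show ?thesis
    using S(2) complete(1) by simp
qed

end
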